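(* Assume Conjecture B (stated in the context). Let $c_0$ be the solution in $(0,1)$ of $2\log c+\log(c+1)+c\log(1+1/c)=1$ (natural logarithm; $c_0\approx0.865722$). Then for every $c>c_0$ there is $b_0$ such that for every prime number $b\ge b_0$ and every positive integer $t\ge cb$, the sequence of iterates $(S_{t,b}^k(n))_{k\ge1}$ diverges for every sufficiently large integer $n$.
   Context: For integers $t\ge 0$, $b\ge 2$, the $t$-shifted Sloane map in base $b$ is $S_{t,b}(n)=\prod_{i=0}^k (d_i+t)$, where $n=\sum_{i=0}^k d_ib^i$ is the base-$b$ expansion of $n$ ($0\le d_i\le b-1$, $d_k>0$); $S_{t,b}^k$ is its $k$-th iterate. For a base $q$, a digit $d$ and a positive integer $n$, $\#d(n)_q$ is the number of occurrences of $d$ in the base-$q$ expansion of $n$ and $\#(n)_q$ the number of base-$q$ digits of $n$. Given $\varepsilon>0$, $n$ is $\varepsilon$-equidistributed in base $q$ if $\left|\frac{\#d(n)_q}{\#(n)_q}-\frac1q\right|<\varepsilon$ for every $d\in\{0,\dots,q-1\}$. Conjecture B: For every integer $q>1$, every finite set $F=\{p_1,\dots,p_k\}$ of primes that does not contain all primes dividing $q$, and every positive integer $a$, for every $\varepsilon>0$ there exists $N$ such that $a\prod_{i=1}^k p_i^{\alpha_i}$ (nonnegative integers $\alpha_i$) is $\varepsilon$-equidistributed in base $q$ whenever $\alpha_i\ge N$ for some $i$. *)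

theory Defs
  imports Complex_Main "HOL-Computational_Algebra.Primes"
begin

text \<open>Base-\<open>b\<close> digits, least significant first. The number \<open>0\<close> has the single digit \<open>0\<close>.
  The guard \<open>b < 2\<close> only serves termination.\<close>

fun digits :: "nat \<Rightarrow> nat \<Rightarrow> nat list" where
  "digits b n = (if b < 2 \<or> n < b then [n] else (n mod b) # digits b (n div b))"

declare digits.simps [simp del]

definition sloane :: "nat \<Rightarrow> nat \<Rightarrow> nat \<Rightarrow> nat" where
  "sloane t b n = (\<Prod>d\<leftarrow>digits b n. d + t)"

definition equidistributed :: "real \<Rightarrow> nat \<Rightarrow> nat \<Rightarrow> bool" where
  "equidistributed \<epsilon> q n \<longleftrightarrow>
     (\<forall>d<q. \<bar>real (count_list (digits q n) d) / real (length (digits q n)) - 1 / real q\<bar> < \<epsilon>)"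

definition conjecture_B :: bool where
  "conjecture_B \<longleftrightarrow>
     (\<forall>q::nat. \<forall>F::nat set. \<forall>a::nat. \<forall>\<epsilon>::real.
        q > 1 \<and> finite F \<and> (\<forall>p\<in>F. prime p) \<and> \<not> {p. prime p \<and> p dvd q} \<subseteq> F \<and> a > 0 \<and> \<epsilon> > 0 \<longrightarrow>
        (\<exists>N::nat. \<forall>\<alpha>::nat \<Rightarrow> nat. (\<exists>p\<in>F. \<alpha> p \<ge> N) \<longrightarrow>
           equidistributed \<epsilon> q (a * (\<Prod>p\<in>F. p ^ \<alpha> p))))"

definition c0 :: real where
  "c0 = (THE c. 0 < c \<and> c < 1 \<and> 2 * ln c + ln (c + 1) + c * ln (1 + 1 / c) = 1)"

lemma digits_sum:
  assumes "b \<ge> 2"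
  shows "(\<Sum>i<length (digits b n). digits b n ! i * b ^ i) = n"
  using assms
proof (induction b n rule: digits.induct)
  case (1 b n)
  show ?case
  proof (cases "n < b")
    case True
    then show ?thesis by (simp add: digits.simps)
  next
    case False
    let ?ds = "digits b (n div b)"
    have eq: "digits b n = (n mod b) # ?ds"
      using False 1(2) by (subst digits.simps) simp
    have IH: "(\<Sum>i<length ?ds. ?ds ! i * b ^ i) = n div b"
      using 1 False by simp
    have "(\<Sum>i<length ?ds. ?ds ! i * b ^ Suc i) = b * (\<Sum>i<length ?ds. ?ds ! i * b ^ i)"
      by (simp add: sum_distrib_left mult_ac)
    then show ?thesis
      unfolding eq using IH by (simp add: sum.lessThan_Suc_shift del: sum.lessThan_Suc power_Suc)
  qed
qed

lemma digits_less:
  assumes "b \<ge> 2" "d \<in> set (digits b n)"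
  shows "d < b"
  using assms
proof (induction b n rule: digits.induct)
  case (1 b n)
  then show ?case
    by (subst (asm) (2) digits.simps) (auto split: if_splits)
qed

lemma digits_not_Nil: "digits b n \<noteq> []"
  by (subst digits.simps) simp

lemma last_digits_pos:
  assumes "b \<ge> 2" "n > 0"
  shows "last (digits b n) > 0"
  using assms
proof (induction b n rule: digits.induct)
  case (1 b n)
  show ?case
  proof (cases "n < b")
    case True
    then show ?thesis using 1 by (simp add: digits.simps)
  next
    case False
    then have "n div b > 0" using 1 by (simp add: div_greater_zero_iff)
    then show ?thesis
      using 1 False by (subst digits.simps) (simp add: digits_not_Nil)
  qed
qed

lemma c0_ex1:
  "\<exists>!c::real. 0 < c \<and> c < 1 \<and> 2 * ln c + ln (c + 1) + c * ln (1 + 1 / c) = 1"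
proof -
  define f :: "real \<Rightarrow> real" where
    "f c = 2 * ln c + ln (c + 1) + c * ln (1 + 1 / c)" for c
  have der: "(f has_real_derivative (2 / c + ln (1 + 1 / c))) (at c)" if "c > 0" for c
  proof -
    have pos: "1 + 1 / c > 0" using that by (simp add: add_pos_pos)
    have "(f has_real_derivative
        (2 * (1 / c) + 1 / (c + 1) + (ln (1 + 1 / c) + c * ((- 1 / (c * c)) / (1 + 1 / c))))) (at c)"
      unfolding f_def using that pos
      by (auto intro!: derivative_eq_intros)
    moreover have "c * ((- 1 / (c * c)) / (1 + 1 / c)) = - (1 / (c + 1))"
      using that by (simp add: divide_simps)
    ultimately show ?thesis by simp
  qed
  have mono: "f x < f y" if "0 < x" "x < y" for x y
  proof (rule DERIV_pos_imp_increasing[OF that(2)])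
    fix z assume z: "x \<le> z" "z \<le> y"
    then have "z > 0" using that by simp
    moreover from this have "2 / z + ln (1 + 1 / z) > 0" by (simp add: add_pos_pos)
    ultimately show "\<exists>w. DERIV f z :> w \<and> w > 0" using der by blast
  qed
  have ln4: "2 * ln 2 > (1::real)"
  proof -
    have "exp 1 < (4::real)" using exp_le by simp
    then have "1 < ln (4::real)" using ln_exp[of 1] ln_less_cancel_iff[of "exp 1" 4] by simp
    also have "ln (4::real) = 2 * ln 2" using ln_realpow[of 2 2] by simp
    finally show ?thesis .
  qed
  have f1: "f 1 > 1" unfolding f_def using ln4 by simp
  have fh: "f (1/2) < 1"
  proof -
    have "ln (3/2) \<le> (3/2 - 1 :: real)" "ln 3 \<le> (3 - 1 :: real)"
      using ln_le_minus_one[of "3/2"] ln_le_minus_one[of 3] by simp_all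
    moreover have "f (1/2) = - 2 * ln 2 + ln (3/2) + 1/2 * ln 3"
      unfolding f_def by (simp add: ln_div)
    ultimately show ?thesis using ln4 by linarith
  qed
  have "\<exists>x\<ge>1/2. x \<le> 1 \<and> f x = 1"
  proof (rule IVT)
    show "\<forall>x. 1/2 \<le> x \<and> x \<le> 1 \<longrightarrow> isCont f x"
      by (auto intro!: DERIV_isCont[OF der])
  qed (use f1 fh in auto)
  then obtain x where x: "1/2 \<le> x" "x \<le> 1" "f x = 1" by blast
  moreover have "x \<noteq> 1" using x f1 by auto
  ultimately have "0 < x \<and> x < 1 \<and> f x = 1" by simp
  moreover have "y = x" if "0 < y \<and> y < 1 \<and> f y = 1" for y
    using mono[of x y] mono[of y x] that calculation by linarith
  ultimately show ?thesis unfolding f_def by blast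
qed

end

theory Submission
  imports Defs
begin

text \<open>If \<open>t \<ge> b\<close>, then \<open>S n \<ge> b ^ len n > n\<close>. Otherwise \<open>b - t\<close> is the only digit \<open>d\<close> for which
  \<open>b\<close> divides \<open>d + t\<close>, so \<open>S n = b ^ k * r\<close>, where \<open>k\<close> counts the digits \<open>b - t\<close> of \<open>n\<close> and all
  prime factors of \<open>r\<close> lie in a fixed finite set without \<open>b\<close>. By Conjecture B, \<open>r\<close> is
  equidistributed once it is long. When at most two thirds of the digits of \<open>b ^ k * r\<close> are
  trailing zeros, the logarithm of \<open>S (b ^ k * r) / b ^ len (b ^ k * r)\<close> is, up to a small error,
  at least \<open>len r\<close> times \<open>2 ln c\<close> plus the integral of \<open>ln\<close> over \<open>[c, c + 1]\<close>, which is positive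
  for \<open>c > c0\<close>; moreover \<open>S (b ^ k * r)\<close> again has few trailing zeros. When there are more trailing
  zeros, they become factors \<open>t\<close> coprime to \<open>b\<close>, and one application of \<open>S\<close> leads back to the
  first case.\<close>

section \<open>Digits\<close>

abbreviation num_digits :: "nat \<Rightarrow> nat \<Rightarrow> nat" where
  "num_digits b n \<equiv> length (digits b n)"

lemma less_power_num_digits:
  assumes "b \<ge> 2"
  shows "n < b ^ num_digits b n"
  using assms
proof (induction b n rule: digits.induct)
  case (1 b n)
  show ?case
  proof (cases "n < b")
    case True
    then show ?thesis by (simp add: digits.simps)
  next
    case False
    then have "n div b < b ^ num_digits b (n div b)" using 1 by simp
    then have "n < b * b ^ num_digits b (n div b)"
      using 1(2) by (simp add: div_less_iff_less_mult mult.commute)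
    then show ?thesis using False 1(2) by (subst digits.simps) simp
  qed
qed

lemma power_num_digits_le:
  assumes "b \<ge> 2" "n > 0"
  shows "b ^ (num_digits b n - 1) \<le> n"
  using assms
proof (induction b n rule: digits.induct)
  case (1 b n)
  show ?case
  proof (cases "n < b")
    case True
    then show ?thesis using 1 by (simp add: digits.simps)
  next
    case False
    then have "n div b > 0" using 1 by (simp add: div_greater_zero_iff)
    then have "b ^ (num_digits b (n div b) - 1) \<le> n div b" using 1 False by simp
    then have "b * b ^ (num_digits b (n div b) - 1) \<le> n"
      using 1(2) by (simp add: less_eq_div_iff_mult_less_eq mult.commute)
    moreover have "num_digits b (n div b) > 0" by (simp add: digits_not_Nil)
    ultimately show ?thesis using False 1(2)
      by (subst digits.simps) (simp flip: power_Suc)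
  qed
qed

lemma less_num_digits_if_power_le:
  assumes "b \<ge> 2" "b ^ j \<le> n"
  shows "j < num_digits b n"
proof -
  have "b ^ j < b ^ num_digits b n"
    using less_power_num_digits[OF assms(1), of n] assms(2) by linarith
  then show ?thesis using assms(1) by (simp add: power_strict_increasing_iff)
qed

lemma digits_power_mult:
  assumes "b \<ge> 2" "r > 0"
  shows "digits b (b ^ k * r) = replicate k 0 @ digits b r"
proof (induction k)
  case (Suc k)
  have "b ^ Suc k * r \<ge> b" using assms by simp
  then have "digits b (b ^ Suc k * r) = 0 # digits b (b ^ k * r)"
    using assms by (subst digits.simps) simp
  then show ?case using Suc by simp
qed simp

lemma sloane_power_mult:
  assumes "b \<ge> 2" "r > 0"
  shows "sloane t b (b ^ k * r) = t ^ k * sloane t b r"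
  using assms by (simp add: sloane_def digits_power_mult prod_list_replicate)

lemma power_le_sloane: "t ^ num_digits b n \<le> sloane t b n"
proof -
  have "t ^ length ds \<le> (\<Prod>d\<leftarrow>ds. d + t)" for ds :: "nat list"
    by (induction ds) (auto intro!: mult_mono)
  then show ?thesis by (simp add: sloane_def)
qed

text \<open>Grouping the factors by digit value puts the logarithm of a Sloane product in a form to
  which equidistribution of the digit counts applies.\<close>

lemma ln_prod_list_eq_sum_count:
  fixes t b :: nat
  assumes "set ds \<subseteq> {..<b}" "t > 0"
  shows "ln (real (\<Prod>d\<leftarrow>ds. d + t)) = (\<Sum>d<b. real (count_list ds d) * ln (real (d + t)))"
  using assms(1)
proof (induction ds)
  case (Cons a ds)
  have pos: "(\<Prod>d\<leftarrow>ds. d + t) > 0" using assms(2) by (induction ds) auto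
  have "(\<Sum>d<b. real (count_list (a # ds) d) * ln (real (d + t))) =
      (\<Sum>d<b. real (count_list ds d) * ln (real (d + t)) + (if d = a then ln (real (d + t)) else 0))"
    by (intro sum.cong) (auto simp: algebra_simps)
  also have "\<dots> = (\<Sum>d<b. real (count_list ds d) * ln (real (d + t))) + ln (real (a + t))"
    using Cons.prems by (simp add: sum.distrib)
  also have "\<dots> = ln (real (\<Prod>d\<leftarrow>ds. d + t)) + ln (real (a + t))"
    using Cons by simp
  also have "\<dots> = ln (real (\<Prod>d\<leftarrow>a # ds. d + t))"
    using pos assms(2) by (simp add: ln_mult del: of_nat_add)
  finally show ?case by simp
qed simp

section \<open>The constant\<close>

text \<open>For c > 0, \<open>threshold_fun c - 1\<close> is \<open>2 * ln c\<close> plus the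
  integral of \<open>ln\<close> over [c, c + 1].\<close>

definition threshold_fun :: "real \<Rightarrow> real" where
  "threshold_fun c = 2 * ln c + ln (c + 1) + c * ln (1 + 1 / c)"

lemma threshold_fun_strict_mono:
  assumes "0 < x" "x < y"
  shows "threshold_fun x < threshold_fun y"
proof (rule DERIV_pos_imp_increasing[OF assms(2)])
  fix c assume "x \<le> c" "c \<le> y"
  then have c: "c > 0" using assms by simp
  have pos: "1 + 1 / c > 0" using c by (simp add: add_pos_pos)
  have "(threshold_fun has_real_derivative
      (2 * (1 / c) + 1 / (c + 1) + (ln (1 + 1 / c) + c * ((- 1 / (c * c)) / (1 + 1 / c))))) (at c)"
    unfolding threshold_fun_def using c pos by (auto intro!: derivative_eq_intros)
  \<comment> \<open>This term cancels \<open>1 / (c + 1)\<close> in the derivative above and leaves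
    \<open>2 / c + ln (1 + 1 / c)\<close>.\<close>
  moreover have "c * ((- 1 / (c * c)) / (1 + 1 / c)) = - (1 / (c + 1))"
    using c by (simp add: divide_simps)
  moreover have "2 / c + ln (1 + 1 / c) > 0" using c by (simp add: add_pos_pos)
  ultimately show "\<exists>w. (threshold_fun has_real_derivative w) (at c) \<and> w > 0" by auto
qed

lemma threshold_fun_c0: "0 < c0" "c0 < 1" "threshold_fun c0 = 1"
  using theI'[OF c0_ex1] unfolding c0_def threshold_fun_def by auto

text \<open>Ensures \<open>b <= 2 * t\<close> whenever \<open>t >= c * b\<close> and
  \<open>c > c0\<close>. By monotonicity it is enough that \<open>threshold_fun (1 / 2) < 1\<close>,
  which follows from ln 4 > 1 and ln x <= x - 1.\<close>

lemma c0_gt_half: "c0 > 1 / 2"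
proof (rule ccontr)
  assume "\<not> c0 > 1 / 2"
  then have "c0 = 1 / 2 \<or> c0 < 1 / 2" by linarith
  then have le: "threshold_fun c0 \<le> threshold_fun (1 / 2)"
    using threshold_fun_strict_mono[OF threshold_fun_c0(1), of "1 / 2"] by (metis order_le_less)
  have "exp 1 < (4::real)" using exp_le by simp
  then have "1 < ln (4::real)" using ln_exp[of 1] ln_less_cancel_iff[of "exp 1" 4] by simp
  also have "ln (4::real) = 2 * ln 2" using ln_realpow[of 2 2] by simp
  finally have "2 * ln 2 > (1::real)" .
  moreover have "ln (3/2) \<le> (3/2 - 1 :: real)" "ln 3 \<le> (3 - 1 :: real)"
    using ln_le_minus_one[of "3/2"] ln_le_minus_one[of 3] by simp_all
  moreover have "threshold_fun (1/2) = - 2 * ln 2 + ln (3/2) + 1/2 * ln 3"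
    unfolding threshold_fun_def by (simp add: ln_div)
  ultimately have "threshold_fun (1/2) < 1" by linarith
  then show False using le threshold_fun_c0(3) by linarith
qed

text \<open>The left side is the integral of \<open>ln\<close> over [x, x + 1], the right side its
  upper Riemann sum with b equal pieces. The antiderivative \<open>F\<close> telescopes over the
  pieces.\<close>

lemma riemann_sum_ln_ge:
  fixes x :: real and b :: nat
  assumes "x > 0" "b > 0"
  shows "(x + 1) * ln (x + 1) - x * ln x - 1 \<le> (\<Sum>d<b. ln (x + real (Suc d) / real b)) / real b"
proof -
  define F :: "real \<Rightarrow> real" where "F y = y * ln y - y" for y
  have step: "F y - F u \<le> (y - u) * ln y" if "0 < u" "u < y" for u y
  proof -
    have "ln (y / u) \<le> y / u - 1" using that by (intro ln_le_minus_one) simp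
    then have "u * ln (y / u) \<le> u * (y / u - 1)" using that by (intro mult_left_mono) auto
    then show ?thesis using that by (simp add: F_def ln_div algebra_simps)
  qed
  let ?p = "\<lambda>d. x + real d / real b"
  have "F (x + 1) - F x = (\<Sum>d<b. F (?p (Suc d)) - F (?p d))"
    using assms sum_lessThan_telescope[of "\<lambda>d. F (?p d)" b] by simp
  also have "\<dots> \<le> (\<Sum>d<b. ln (?p (Suc d)) / real b)"
  proof (rule sum_mono)
    fix d
    have "F (?p (Suc d)) - F (?p d) \<le> (?p (Suc d) - ?p d) * ln (?p (Suc d))"
      using assms by (intro step) (auto simp: divide_simps intro: add_pos_nonneg)
    also have "?p (Suc d) - ?p d = 1 / real b" by (simp add: add_divide_distrib)
    finally show "F (?p (Suc d)) - F (?p d) \<le> ln (?p (Suc d)) / real b" by simp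
  qed
  finally show ?thesis by (simp add: F_def sum_divide_distrib)
qed

lemma mean_log_digit_ge:
  fixes x :: real and b t :: nat
  assumes "x > 0" "b > 0" "real t - 1 \<ge> x * real b"
  shows "threshold_fun x - 1 \<le>
    2 * ln (real t / real b) + (\<Sum>d<b. ln (real (d + t) / real b)) / real b"
proof -
  \<comment> \<open>The points \<open>(d + t) / b\<close> are the right endpoints
    \<open>y + (d + 1) / b\<close> of a Riemann sum starting at this \<open>y\<close>; hence the
    \<open>- 1\<close>.\<close>
  define y where "y = (real t - 1) / real b"
  have y: "y \<ge> x" "y > 0" using assms by (simp_all add: y_def field_simps order_less_le_trans)
  have "threshold_fun x - 1 \<le> threshold_fun y - 1"
    using threshold_fun_strict_mono[of x y] assms(1) y by (cases "x = y") auto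
  also have "threshold_fun y - 1 = 2 * ln y + ((y + 1) * ln (y + 1) - y * ln y - 1)"
  proof -
    have "1 + 1 / y = (y + 1) / y" using y by (simp add: field_simps)
    then have "ln (1 + 1 / y) = ln (y + 1) - ln y" using y by (simp add: ln_div)
    then show ?thesis by (simp only: threshold_fun_def) (simp add: algebra_simps)
  qed
  also have "\<dots> \<le> 2 * ln y + (\<Sum>d<b. ln (y + real (Suc d) / real b)) / real b"
    using riemann_sum_ln_ge[OF y(2) assms(2)] by simp
  also have "\<dots> \<le> 2 * ln (real t / real b) + (\<Sum>d<b. ln (y + real (Suc d) / real b)) / real b"
  proof -
    have "y \<le> real t / real b" by (simp add: y_def divide_right_mono)
    then have "ln y \<le> ln (real t / real b)" using y(2) by simp
    then show ?thesis by simp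
  qed
  also have "(\<lambda>d. y + real (Suc d) / real b) = (\<lambda>d. real (d + t) / real b)"
    using assms(2) by (auto simp: y_def field_simps)
  finally show ?thesis .
qed

section \<open>Shifts smaller than the base\<close>

locale small_shift =
  fixes b t :: nat
  assumes prime_b: "prime b" and b_ge: "b \<ge> 4" and t_less: "t < b" and t_ge: "b \<le> 2 * t"
begin

section \<open>Prime factors of Sloane products and equidistribution\<close>

lemma b_ge_2: "b \<ge> 2"
  using b_ge by simp

lemma t_pos: "t > 0"
  using b_ge t_ge by simp

text \<open>These are the products of powers of a fixed finite set of primes without b, the shape
  that Conjecture B treats in base b with a = 1. The bound is \<open>2 * b\<close> because every
  digit factor \<open>d + t\<close> is smaller than that.\<close>

definition admissible :: "nat \<Rightarrow> bool" where
  "admissible r \<longleftrightarrow> r > 0 \<and> (\<forall>p. prime p \<longrightarrow> p dvd r \<longrightarrow> p < 2 * b \<and> p \<noteq> b)"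

lemma admissible_mult: "admissible r \<Longrightarrow> admissible s \<Longrightarrow> admissible (r * s)"
  by (auto simp: admissible_def prime_dvd_mult_iff)

text \<open>Since 0 < d + t < 2 b, the only multiple of b in reach is b itself, attained just at d =
  b - t.\<close>

lemma admissible_digit_shift:
  assumes "d < b" "d \<noteq> b - t"
  shows "admissible (d + t)"
proof -
  have "p < 2 * b \<and> p \<noteq> b" if p: "prime p" "p dvd d + t" for p
  proof -
    have "p < 2 * b" using dvd_imp_le[OF p(2)] assms t_less t_pos by simp
    moreover have "p \<noteq> b"
    proof
      assume "p = b"
      then obtain j where j: "d + t = b * j" using p by blast
      then have "b * j < b * 2" "b * j > 0" using assms t_less t_pos by linarith+
      then have "j = 1" by simp
      then show False using j assms t_less by simp
    qed
    ultimately show ?thesis ..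
  qed
  then show ?thesis using t_pos by (simp add: admissible_def)
qed

lemma sloane_factorization:
  obtains r where "admissible r" "sloane t b n = b ^ count_list (digits b n) (b - t) * r"
proof -
  have "\<exists>r. admissible r \<and> (\<Prod>d\<leftarrow>ds. d + t) = b ^ count_list ds (b - t) * r"
    if "set ds \<subseteq> {..<b}" for ds
    using that
  proof (induction ds)
    case Nil
    then show ?case by (auto simp: admissible_def intro: exI[of _ 1])
  next
    case (Cons d ds)
    then obtain r where r: "admissible r" "(\<Prod>d\<leftarrow>ds. d + t) = b ^ count_list ds (b - t) * r"
      by auto
    show ?case
    proof (cases "d = b - t")
      case True
      then show ?thesis using r t_less by (intro exI[of _ r]) simp
    next
      case False
      then have "admissible ((d + t) * r)"
        using Cons.prems r by (intro admissible_mult admissible_digit_shift) auto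
      then show ?thesis using r False by (intro exI[of _ "(d + t) * r"]) simp
    qed
  qed
  from this[of "digits b n"] show ?thesis
    using that digits_less[OF b_ge_2] by (auto simp: sloane_def)
qed

text \<open>Conjecture B asks for one exponent that is at least \<open>N\<close>. If all exponents
  were smaller, \<open>r\<close> could not exceed the constant \<open>P\<close>; so every long
  \<open>r\<close> qualifies.\<close>

lemma admissible_equidistributed:
  assumes "conjecture_B" "\<epsilon> > 0"
  obtains R where "\<And>r. admissible r \<Longrightarrow> num_digits b r > R \<Longrightarrow> equidistributed \<epsilon> b r"
proof -
  define F where "F = {p. prime p \<and> p < 2 * b \<and> p \<noteq> b}"
  have fin: "finite F" unfolding F_def by (rule finite_subset[of _ "{..<2 * b}"]) auto
  have "\<not> {p. prime p \<and> p dvd b} \<subseteq> F" using prime_b by (auto simp: F_def)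
  moreover have "\<forall>p\<in>F. prime p" by (simp add: F_def)
  ultimately have "b > 1 \<and> finite F \<and> (\<forall>p\<in>F. prime p) \<and> \<not> {p. prime p \<and> p dvd b} \<subseteq> F
      \<and> (1::nat) > 0 \<and> \<epsilon> > 0"
    using assms(2) b_ge fin by auto
  from assms(1)[unfolded conjecture_B_def, rule_format, OF this]
  obtain N where N: "\<And>\<alpha>. \<exists>p\<in>F. \<alpha> p \<ge> N \<Longrightarrow> equidistributed \<epsilon> b (1 * (\<Prod>p\<in>F. p ^ \<alpha> p))"
    by blast
  \<comment> \<open>\<open>P\<close> serves also as the bound on the number of digits: more than
    \<open>P\<close> digits force \<open>r >= b ^ P > P\<close>.\<close>
  define P where "P = (\<Prod>p\<in>F. p ^ N)"
  have "equidistributed \<epsilon> b r" if r: "admissible r" "num_digits b r > P" for r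
  proof -
    have sub: "prime_factors r \<subseteq> F" using r by (auto simp: admissible_def F_def in_prime_factors_iff)
    have "r = (\<Prod>p\<in>prime_factors r. p ^ multiplicity p r)"
      using r by (simp add: admissible_def prod_prime_factors)
    also have "\<dots> = (\<Prod>p\<in>F. p ^ multiplicity p r)"
    proof (intro prod.mono_neutral_left[OF fin sub] ballI)
      fix p assume "p \<in> F - prime_factors r"
      then have "\<not> p dvd r" using r by (auto simp: F_def admissible_def in_prime_factors_iff)
      then show "p ^ multiplicity p r = 1" by (simp add: not_dvd_imp_multiplicity_0)
    qed
    finally have eq: "r = (\<Prod>p\<in>F. p ^ multiplicity p r)" .
    have "\<exists>p\<in>F. multiplicity p r \<ge> N"
    proof (rule ccontr)
      assume "\<not> ?thesis"
      then have "(\<Prod>p\<in>F. p ^ multiplicity p r) \<le> P"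
        unfolding P_def by (intro prod_mono) (auto simp: F_def prime_gt_0_nat intro!: power_increasing Suc_leI)
      then have "r \<le> P" using eq by simp
      moreover have "P < b ^ P" using b_ge_2 by (intro power_gt_expt) simp
      moreover have "b ^ P \<le> b ^ (num_digits b r - 1)" using r b_ge_2 by (intro power_increasing) auto
      moreover have "\<dots> \<le> r" using r b_ge_2 by (intro power_num_digits_le) (auto simp: admissible_def)
      ultimately show False by linarith
    qed
    from N[of "\<lambda>p. multiplicity p r", OF this] show ?thesis using eq by simp
  qed
  then show ?thesis using that by blast
qed

section \<open>Growth under one application of the Sloane map\<close>

lemma power_less_sloane:
  assumes eq: "equidistributed \<epsilon> b r" and r: "r > 0" and k: "k \<le> 2 * num_digits b r"
    and mean: "\<epsilon> * real b < 2 * ln (real t / real b) + (\<Sum>d<b. ln (real (d + t) / real b)) / real b"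
  shows "b ^ (k + num_digits b r) < sloane t b (b ^ k * r)"
proof -
  define L where "L = real (num_digits b r)"
  define C where "C d = real (count_list (digits b r) d)" for d
  \<comment> \<open>Since the digit counts \<open>C d\<close> add up to \<open>L\<close>, dividing
    by the power of b and taking logarithms turns the claim into positivity of
    \<open>k * x 0\<close> plus the sum of all \<open>C d * x d\<close>.\<close>
  define x where "x d = ln (real (d + t) / real b)" for d
  have L: "L > 0" by (simp add: L_def digits_not_Nil)
  have b: "real b > 0" using b_ge by simp
  have ln_eq: "ln (real (d + t)) = ln (real b) + x d" for d
    using b t_pos by (simp add: x_def ln_div del: of_nat_add)
  have set_ds: "set (digits b r) \<subseteq> {..<b}" using digits_less[OF b_ge_2] by auto
  have "(\<Sum>d<b. count_list (digits b r) d) = num_digits b r"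
    using sum_count_set[OF set_ds] by simp
  then have C_sum: "(\<Sum>d<b. C d) = L" unfolding C_def L_def by (metis of_nat_sum)
  \<comment> \<open>As \<open>(d + t) / b\<close> lies in [1/2, 2], |x d| is at most 1, so replacing
    \<open>C d\<close> by \<open>L / b\<close> costs at most \<open>L * \<epsilon>\<close>.\<close>
  have C_x: "L * x d / real b - L * \<epsilon> \<le> C d * x d" if d: "d < b" for d
  proof -
    define y where "y = real (d + t) / real b"
    have y: "y \<le> 2" "y \<ge> 1 / 2" using d b t_less t_ge by (simp_all add: y_def field_simps)
    have "ln y \<le> y - 1" using y by (intro ln_le_minus_one) auto
    then have "x d \<le> 1" using y unfolding x_def y_def[symmetric] by linarith
    moreover have "ln (1 / y) \<le> 1 / y - 1" using y by (intro ln_le_minus_one) auto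
    then have "x d \<ge> 1 - 1 / y" using y unfolding x_def y_def[symmetric] by (simp add: ln_div)
    moreover have "1 / y \<le> 2" using y by (simp add: field_simps)
    ultimately have x: "\<bar>x d\<bar> \<le> 1" by linarith
    have "\<bar>C d / L - 1 / real b\<bar> < \<epsilon>"
      using eq d unfolding equidistributed_def C_def L_def by blast
    then have "\<bar>C d / L - 1 / real b\<bar> * \<bar>x d\<bar> \<le> \<epsilon> * 1" using x by (intro mult_mono) auto
    then have "- \<epsilon> \<le> (C d / L - 1 / real b) * x d" by (simp flip: abs_mult)
    then have "L * (- \<epsilon>) \<le> L * ((C d / L - 1 / real b) * x d)"
      using L by (intro mult_left_mono) auto
    then show ?thesis using L by (simp add: algebra_simps)
  qed
  have "L * ((\<Sum>d<b. x d) / real b - \<epsilon> * real b) = (\<Sum>d<b. L * x d / real b - L * \<epsilon>)"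
    by (simp add: sum_subtractf sum_distrib_left sum_divide_distrib algebra_simps)
  also have "\<dots> \<le> (\<Sum>d<b. C d * x d)" using C_x by (intro sum_mono) auto
  finally have sum_x: "L * ((\<Sum>d<b. x d) / real b - \<epsilon> * real b) \<le> (\<Sum>d<b. C d * x d)" .
  \<comment> \<open>Since t < b, \<open>x 0\<close> is negative and k = 2 L is the worst case; this
    is the origin of \<open>2 * ln c\<close> in the threshold.\<close>
  have "real k * x 0 \<ge> 2 * L * x 0"
    using k t_less b t_pos by (intro mult_right_mono_neg) (auto simp: L_def x_def)
  moreover have "0 < L * (2 * x 0 + (\<Sum>d<b. x d) / real b - \<epsilon> * real b)"
    using mean L by (intro mult_pos_pos) (auto simp: x_def)
  ultimately have pos: "0 < real k * x 0 + (\<Sum>d<b. C d * x d)"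
    using sum_x by (simp add: algebra_simps)
  have S_pos: "sloane t b r > 0" using power_le_sloane[of t b r] t_pos
    by (meson order_less_le_trans zero_less_power)
  have "ln (real (b ^ (k + num_digits b r))) = (real k + L) * ln (real b)"
    using b by (simp add: ln_realpow L_def)
  also have "\<dots> < (real k + L) * ln (real b) + (real k * x 0 + (\<Sum>d<b. C d * x d))"
    using pos by simp
  also have "\<dots> = real k * ln (real (0 + t)) + (\<Sum>d<b. C d * ln (real (d + t)))"
    unfolding ln_eq by (simp add: distrib_left sum.distrib C_sum distrib_right flip: sum_distrib_right)
  also have "\<dots> = real k * ln (real t) + ln (real (sloane t b r))"
    using ln_prod_list_eq_sum_count[OF set_ds t_pos] by (simp add: sloane_def C_def)
  also have "\<dots> = ln (real (sloane t b (b ^ k * r)))"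
    using r b_ge_2 t_pos S_pos by (simp add: sloane_power_mult ln_mult ln_realpow)
  finally have "real (b ^ (k + num_digits b r)) < real (sloane t b (b ^ k * r))"
    using r b_ge_2 t_pos S_pos b
    by (subst (asm) ln_less_cancel_iff) (auto simp: sloane_power_mult)
  then show ?thesis by linarith
qed

text \<open>Because \<open>b <= t * t\<close>, one application loses less than half of the digits.
  This controls the iterates before growth sets in.\<close>

lemma num_digits_less_sloane: "num_digits b n < 2 * num_digits b (sloane t b n)"
proof -
  have "b \<le> t * 2" using t_ge by simp
  also have "\<dots> \<le> t * t" using b_ge t_ge by (intro mult_left_mono) auto
  finally have "b ^ num_digits b n \<le> (t ^ num_digits b n) ^ 2"
    using power_mono[of b "t * t" "num_digits b n"] by (simp add: power2_eq_square power_mult_distrib)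
  also have "\<dots> \<le> sloane t b n ^ 2" using power_le_sloane by (intro power_mono) auto
  also have "\<dots> < (b ^ num_digits b (sloane t b n)) ^ 2"
    using less_power_num_digits[OF b_ge_2] by (intro power_strict_mono) auto
  finally have "b ^ num_digits b n < b ^ (2 * num_digits b (sloane t b n))"
    by (simp add: power_mult mult.commute flip: power_mult)
  then show ?thesis using b_ge by (simp add: power_strict_increasing_iff)
qed

section \<open>Trailing zeros along the iteration\<close>

lemma num_digits_power_mult: "r > 0 \<Longrightarrow> num_digits b (b ^ k * r) = k + num_digits b r"
  by (simp add: digits_power_mult[OF b_ge_2])

lemma count_digits_power_mult:
  "r > 0 \<Longrightarrow> count_list (digits b (b ^ k * r)) (b - t) = count_list (digits b r) (b - t)"
proof -
  assume "r > 0"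
  moreover have "count_list (replicate k 0) (b - t) = 0"
    using t_less by (intro count_notin) auto
  ultimately show ?thesis by (simp add: digits_power_mult[OF b_ge_2])
qed

text \<open>The invariant of the iteration. The bound on \<open>k\<close> gives n at most three
  times as many digits as \<open>r\<close>, so \<open>r\<close> has more than \<open>R\<close>
  digits and is long enough for equidistribution. The length condition is on n because that length
  grows.\<close>

definition few_trailing_zeros :: "nat \<Rightarrow> nat \<Rightarrow> bool" where
  "few_trailing_zeros R n \<longleftrightarrow>
     (\<exists>k r. n = b ^ k * r \<and> admissible r \<and> k \<le> 2 * num_digits b r \<and> 3 * R < num_digits b n)"

lemma few_trailing_zeros_sloaneI:
  assumes "3 * count_list (digits b n) (b - t) \<le> 2 * num_digits b (sloane t b n)"
    and "3 * R < num_digits b (sloane t b n)"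
  shows "few_trailing_zeros R (sloane t b n)"
proof -
  obtain r where r: "admissible r" "sloane t b n = b ^ count_list (digits b n) (b - t) * r"
    by (rule sloane_factorization)
  then have "num_digits b (sloane t b n) = count_list (digits b n) (b - t) + num_digits b r"
    by (simp add: num_digits_power_mult admissible_def)
  \<comment> \<open>The number of digits is the count plus \<open>num_digits b r\<close>;
    subtracting twice the count in the first assumption leaves the bound on
    \<open>k\<close>.\<close>
  then show ?thesis using assms r unfolding few_trailing_zeros_def by auto
qed

text \<open>Each application keeps more than half of the digits, so \<open>12 * R + 4\<close> digits
  leave more than \<open>3 * R\<close> after two.\<close>

lemma few_trailing_zeros_eventually:
  assumes "num_digits b m \<ge> 12 * R + 4"
  shows "few_trailing_zeros R (sloane t b m) \<or> few_trailing_zeros R (sloane t b (sloane t b m))"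
proof -
  define n where "n = sloane t b m"
  obtain r where r: "admissible r" "n = b ^ count_list (digits b m) (b - t) * r"
    unfolding n_def by (rule sloane_factorization)
  define k where "k = count_list (digits b m) (b - t)"
  have len: "num_digits b n = k + num_digits b r"
    using r by (simp add: num_digits_power_mult admissible_def k_def)
  have big: "num_digits b m < 2 * num_digits b n" "num_digits b n < 2 * num_digits b (sloane t b n)"
    using num_digits_less_sloane by (simp_all add: n_def)
  show ?thesis
  proof (cases "k \<le> 2 * num_digits b r")
    case True
    then have "few_trailing_zeros R (sloane t b m)"
      using big len assms by (intro few_trailing_zeros_sloaneI) (auto simp: n_def k_def)
    then show ?thesis ..
  next
    case False
    \<comment> \<open>Trailing zeros differ from the digit \<open>b - t\<close>, which therefore
      occurs at most \<open>num_digits b r\<close> times, less than a third of the length of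
      \<open>n\<close>. As \<open>sloane t b n\<close> keeps more than half of that length, this is
      few enough.\<close>
    have "count_list (digits b n) (b - t) = count_list (digits b r) (b - t)"
      using r by (simp add: count_digits_power_mult admissible_def)
    also have "\<dots> \<le> num_digits b r" by (rule count_le_length)
    finally have "few_trailing_zeros R (sloane t b n)"
      using False big len assms by (intro few_trailing_zeros_sloaneI) auto
    then show ?thesis by (simp add: n_def)
  qed
qed

text \<open>The factors b of the next iterate come from the digits \<open>b - t\<close> of
  \<open>r\<close>, whose share is by equidistribution below 1/b + \<epsilon> <= 1/4 + 1/3 <
  2/3.\<close>

lemma few_trailing_zeros_step:
  assumes R: "\<And>r. admissible r \<Longrightarrow> num_digits b r > R \<Longrightarrow> equidistributed \<epsilon> b r"
    and \<epsilon>: "\<epsilon> \<le> 1 / 3"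
    and mean: "\<epsilon> * real b < 2 * ln (real t / real b) + (\<Sum>d<b. ln (real (d + t) / real b)) / real b"
    and n: "few_trailing_zeros R n"
  shows "n < sloane t b n" "few_trailing_zeros R (sloane t b n)"
proof -
  obtain k r where r: "n = b ^ k * r" "admissible r" "k \<le> 2 * num_digits b r"
      "3 * R < num_digits b n"
    using n unfolding few_trailing_zeros_def by blast
  then have r0: "r > 0" by (simp add: admissible_def)
  have len: "num_digits b n = k + num_digits b r" using r r0 by (simp add: num_digits_power_mult)
  then have eq: "equidistributed \<epsilon> b r" using r by (intro R) auto
  have less: "b ^ num_digits b n < sloane t b n"
    using power_less_sloane[OF eq r0 r(3) mean] r(1) len by simp
  then show "n < sloane t b n" using less_power_num_digits[OF b_ge_2, of n] by linarith
  have longer: "num_digits b n < num_digits b (sloane t b n)"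
    using less b_ge_2 by (intro less_num_digits_if_power_le) auto
  have L: "real (num_digits b r) > 0" by (simp add: digits_not_Nil)
  have "b - t < b" using t_pos b_ge by simp
  then have "\<bar>real (count_list (digits b r) (b - t)) / real (num_digits b r) - 1 / real b\<bar> < \<epsilon>"
    using eq unfolding equidistributed_def by blast
  moreover have "1 / real b \<le> 1 / 4" using b_ge by (simp add: field_simps)
  ultimately have "real (count_list (digits b r) (b - t)) / real (num_digits b r) \<le> 2 / 3"
    using \<epsilon> by linarith
  then have "3 * real (count_list (digits b r) (b - t)) \<le> 2 * real (num_digits b r)"
    using L by (simp add: field_simps)
  then have "3 * count_list (digits b n) (b - t) \<le> 2 * num_digits b r"
    using r0 r(1) by (simp add: count_digits_power_mult)
  then show "few_trailing_zeros R (sloane t b n)"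
    using longer len r(4) by (intro few_trailing_zeros_sloaneI) linarith+
qed

end

section \<open>Divergence\<close>

text \<open>A strictly increasing sequence of naturals is unbounded; \<open>j\<close> skips initial
  iterates at which \<open>P\<close> may fail.\<close>

lemma filterlim_funpow_at_top:
  fixes f :: "nat \<Rightarrow> nat"
  assumes "\<And>x. P x \<Longrightarrow> x < f x \<and> P (f x)" and "P ((f ^^ j) n)"
  shows "filterlim (\<lambda>k. (f ^^ k) n) at_top sequentially"
proof -
  have P: "P ((f ^^ (k + j)) n)" for k
    using assms by (induction k) auto
  have "strict_mono (\<lambda>k. (f ^^ (k + j)) n)"
    using assms(1)[OF P] by (simp add: strict_mono_Suc_iff)
  then have "filterlim (\<lambda>k. (f ^^ (k + j)) n) at_top sequentially"
    by (rule filterlim_subseq)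
  then show ?thesis
    unfolding filterlim_at_top using eventually_sequentially_seg[of _ j] by blast
qed

theorem theorem23:
  assumes "conjecture_B"
  shows "\<forall>c::real. c > c0 \<longrightarrow>
    (\<exists>b0::nat. \<forall>b::nat. prime b \<and> b \<ge> b0 \<longrightarrow>
      (\<forall>t::nat. t > 0 \<and> real t \<ge> c * real b \<longrightarrow>
        (\<exists>n0::nat. \<forall>n\<ge>n0. filterlim (\<lambda>k. (sloane t b ^^ k) n) at_top sequentially)))"
proof (intro allI impI)
  fix c :: real assume c: "c > c0"
  \<comment> \<open>The gap between \<open>c0\<close> and \<open>c'\<close> yields the margin
    \<open>\<delta>\<close>; the gap between \<open>c'\<close> and \<open>c\<close> absorbs the
    shift from t to t - 1 in the Riemann sum once b >= 1 / (c - c').\<close>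
  define c' where "c' = (c0 + c) / 2"
  have c': "c0 < c'" "c' < c" "1 / 2 < c'" "0 < c'" using c c0_gt_half by (auto simp: c'_def)
  define \<delta> where "\<delta> = threshold_fun c' - 1"
  have \<delta>: "\<delta> > 0"
    using threshold_fun_strict_mono[OF threshold_fun_c0(1) c'(1)] threshold_fun_c0(3)
    by (simp add: \<delta>_def)
  define b0 where "b0 = nat \<lceil>1 / (c - c')\<rceil> + 4"
  have "\<exists>n0::nat. \<forall>n\<ge>n0. filterlim (\<lambda>k. (sloane t b ^^ k) n) at_top sequentially"
    if b: "prime b" "b \<ge> b0" and t: "t > 0" "real t \<ge> c * real b" for b t :: nat
  proof (cases "t < b")
    case False
    have b2: "b \<ge> 2" using b by (simp add: b0_def)
    have "n < sloane t b n" for n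
    proof -
      have "n < b ^ num_digits b n" using b2 by (rule less_power_num_digits)
      also have "\<dots> \<le> t ^ num_digits b n" using False by (intro power_mono) auto
      also have "\<dots> \<le> sloane t b n" by (rule power_le_sloane)
      finally show ?thesis .
    qed
    then show ?thesis
      using filterlim_funpow_at_top[of "\<lambda>_. True" "sloane t b" 0] by auto
  next
    case True
    have b4: "b \<ge> 4" using b by (simp add: b0_def)
    have "1 / 2 * real b \<le> c * real b" using c' by (intro mult_right_mono) auto
    then have "b \<le> 2 * t" using t by linarith
    then interpret small_shift b t using b b4 True by unfold_locales auto
    have "1 / (c - c') \<le> real b" using b unfolding b0_def by linarith
    then have "1 \<le> (c - c') * real b" using c' by (simp add: field_simps)
    then have "real t - 1 \<ge> c' * real b" using t by (simp add: algebra_simps)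
    then have mean: "\<delta> \<le> 2 * ln (real t / real b) + (\<Sum>d<b. ln (real (d + t) / real b)) / real b"
      unfolding \<delta>_def using c' b4 by (intro mean_log_digit_ge) auto
    \<comment> \<open>All b digit values together then cost at most half of the margin
      \<open>\<delta>\<close>; the 1/3 is for the share of the digit \<open>b - t\<close>.\<close>
    define \<epsilon> where "\<epsilon> = min (1 / 3) (\<delta> / (2 * real b))"
    have \<epsilon>: "\<epsilon> > 0" "\<epsilon> \<le> 1 / 3" using \<delta> b4 by (simp_all add: \<epsilon>_def)
    have "\<epsilon> * real b \<le> \<delta> / (2 * real b) * real b" by (intro mult_right_mono) (auto simp: \<epsilon>_def)
    also have "\<dots> = \<delta> / 2" using b4 by simp
    finally have "\<epsilon> * real b < \<delta>" using \<delta> by linarith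
    with mean have mean': "\<epsilon> * real b <
        2 * ln (real t / real b) + (\<Sum>d<b. ln (real (d + t) / real b)) / real b" by linarith
    obtain R where R: "\<And>r. admissible r \<Longrightarrow> num_digits b r > R \<Longrightarrow> equidistributed \<epsilon> b r"
      using admissible_equidistributed[OF assms \<epsilon>(1)] by blast
    have step: "n < sloane t b n \<and> few_trailing_zeros R (sloane t b n)"
      if "few_trailing_zeros R n" for n
      using few_trailing_zeros_step[OF R \<epsilon>(2) mean' that] by blast
    show ?thesis
    proof (intro exI allI impI)
      fix n assume "n \<ge> b ^ (12 * R + 4)"
      then have "num_digits b n \<ge> 12 * R + 4"
        using less_num_digits_if_power_le[OF b_ge_2] by (simp add: less_imp_le)
      then have "\<exists>j. few_trailing_zeros R ((sloane t b ^^ j) n)"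
        using few_trailing_zeros_eventually[of R n]
        by (auto intro: exI[of _ 1] exI[of _ "Suc 1"])
      then show "filterlim (\<lambda>k. (sloane t b ^^ k) n) at_top sequentially"
        using filterlim_funpow_at_top[of "few_trailing_zeros R" "sloane t b"] step by blast
    qed
  qed
  then show "\<exists>b0::nat. \<forall>b::nat. prime b \<and> b \<ge> b0 \<longrightarrow>
      (\<forall>t::nat. t > 0 \<and> real t \<ge> c * real b \<longrightarrow>
        (\<exists>n0::nat. \<forall>n\<ge>n0. filterlim (\<lambda>k. (sloane t b ^^ k) n) at_top sequentially))"
    by blast
qed

end
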